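(* Let $(X,\mu,m)$ be a connected weighted graph which admits a compatible intrinsic metric $\rho$, let $o\in X$ be a fixed vertex and $B_r=\{x\in X\mid\rho(x,o)\le r\}$, $r\ge0$. If $$\int_1^\infty\frac{r}{m(B_r)}\,dr=\infty,$$ then the graph is recurrent.
   Context: Weighted graph: $X$ is a countable discrete set, $m:X\to(0,\infty)$ is extended additively to a measure on all subsets of $X$, and $\mu:X\times X\to[0,\infty)$, $(x,y)\mapsto\mu_{xy}$, is symmetric, zero on the diagonal, and satisfies $\sum_{y\in X}\mu_{xy}<\infty$ for all $x\in X$ (local finiteness is not assumed). Write $x\sim y$ if $\mu_{xy}>0$. The graph is connected if any two vertices $x,y$ are joined by a path $x=x_0\sim x_1\sim\dots\sim x_n=y$. Compatible intrinsic metric: a pseudo metric is a symmetric map $\rho:X\times X\to[0,\infty)$ with zero diagonal satisfying the triangle inequality. It is intrinsic if $\sum_{y\in X}\mu_{xy}\rho^2(x,y)\le m(x)$ for all $x\in X$. Its jump size is $s=\sup\{\rho(x,y)\mid x\sim y\}$. The weighted vertex degree is $\mathrm{Deg}(x)=\frac1{m(x)}\sum_{y\in X}\mu_{xy}$. A pseudo metric is compatible if $s<\infty$ and $\mathrm{Deg}$ is bounded on each ball $B_r$, $r\ge0$. In the integrand, $r/\infty=0$. Recurrence: let $P$ be the transition matrix $P_{x,y}=\mu_{xy}/\sum_{z\in X}\mu_{xz}$ and $P^{(n)}$ its $n$-th power. The connected graph is recurrent if $\sum_{n=0}^\infty P^{(n)}(x,y)=\infty$ for some (equivalently, all) $x,y\in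 X$. Well-known equivalent conditions, any of which may be taken as the definition, are: every bounded superharmonic function is constant; every non-negative superharmonic function is constant; $\inf\{E(f)\mid f\in C_c(X), f(x)=1\}=0$ for some (all) $x\in X$. Here $E(f)=\frac12\sum_{x,y}\mu_{xy}|f(x)-f(y)|^2$, $C_c(X)$ is the space of finitely supported functions, and $f:X\to\mathbb{R}$ is superharmonic if for all $x\in X$ both $\sum_y\mu_{xy}|f(y)|<\infty$ and $\frac1{m(x)}\sum_y\mu_{xy}(f(x)-f(y))\ge0$. *)

theory Defs
  imports "HOL-Analysis.Analysis"
begin

text \<open>The vertex set is a carrier set \<open>X\<close>; values of \<open>\<mu>\<close>, \<open>m\<close>, \<open>\<rho>\<close> and of functions outside
  \<open>X\<close> are irrelevant. Local finiteness is not assumed.\<close>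

locale weighted_graph =
  fixes X :: "'a set" and \<mu> :: "'a \<Rightarrow> 'a \<Rightarrow> real" and m :: "'a \<Rightarrow> real"
  assumes countable_X: "countable X"
    and m_pos: "x \<in> X \<Longrightarrow> m x > 0"
    and \<mu>_nonneg: "x \<in> X \<Longrightarrow> y \<in> X \<Longrightarrow> \<mu> x y \<ge> 0"
    and \<mu>_sym: "x \<in> X \<Longrightarrow> y \<in> X \<Longrightarrow> \<mu> x y = \<mu> y x"
    and \<mu>_diag: "x \<in> X \<Longrightarrow> \<mu> x x = 0"
    and \<mu>_summable: "x \<in> X \<Longrightarrow> \<mu> x summable_on X"

definition adj :: "'a set \<Rightarrow> ('a \<Rightarrow> 'a \<Rightarrow> real) \<Rightarrow> 'a \<Rightarrow> 'a \<Rightarrow> bool" where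
  "adj X \<mu> x y \<longleftrightarrow> x \<in> X \<and> y \<in> X \<and> \<mu> x y > 0"

definition connected_graph :: "'a set \<Rightarrow> ('a \<Rightarrow> 'a \<Rightarrow> real) \<Rightarrow> bool" where
  "connected_graph X \<mu> \<longleftrightarrow> (\<forall>x\<in>X. \<forall>y\<in>X. (adj X \<mu>)\<^sup>*\<^sup>* x y)"

definition vertex_measure :: "'a set \<Rightarrow> ('a \<Rightarrow> real) \<Rightarrow> 'a measure" where
  "vertex_measure X m = point_measure X (\<lambda>x. ennreal (m x))"

definition weighted_deg :: "'a set \<Rightarrow> ('a \<Rightarrow> 'a \<Rightarrow> real) \<Rightarrow> ('a \<Rightarrow> real) \<Rightarrow> 'a \<Rightarrow> real" where
  "weighted_deg X \<mu> m x = 1 / m x * (\<Sum>\<^sub>\<infinity>y\<in>X. \<mu> x y)"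

definition pseudo_metric_on :: "'a set \<Rightarrow> ('a \<Rightarrow> 'a \<Rightarrow> real) \<Rightarrow> bool" where
  "pseudo_metric_on X \<rho> \<longleftrightarrow>
     (\<forall>x\<in>X. \<forall>y\<in>X. \<rho> x y \<ge> 0 \<and> \<rho> x y = \<rho> y x) \<and>
     (\<forall>x\<in>X. \<rho> x x = 0) \<and>
     (\<forall>x\<in>X. \<forall>y\<in>X. \<forall>z\<in>X. \<rho> x z \<le> \<rho> x y + \<rho> y z)"

text \<open>The summability clause is part of the bound by \<open>m x\<close>: a divergent \<^const>\<open>infsum\<close> over the
  reals is \<open>0\<close>.\<close>

definition intrinsic_metric ::
  "'a set \<Rightarrow> ('a \<Rightarrow> 'a \<Rightarrow> real) \<Rightarrow> ('a \<Rightarrow> real) \<Rightarrow> ('a \<Rightarrow> 'a \<Rightarrow> real) \<Rightarrow> bool" where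
  "intrinsic_metric X \<mu> m \<rho> \<longleftrightarrow> pseudo_metric_on X \<rho> \<and>
     (\<forall>x\<in>X. (\<lambda>y. \<mu> x y * (\<rho> x y)\<^sup>2) summable_on X \<and> (\<Sum>\<^sub>\<infinity>y\<in>X. \<mu> x y * (\<rho> x y)\<^sup>2) \<le> m x)"

definition metric_ball :: "'a set \<Rightarrow> ('a \<Rightarrow> 'a \<Rightarrow> real) \<Rightarrow> 'a \<Rightarrow> real \<Rightarrow> 'a set" where
  "metric_ball X \<rho> x\<^sub>0 r = {x \<in> X. \<rho> x x\<^sub>0 \<le> r}"

definition jump_size :: "'a set \<Rightarrow> ('a \<Rightarrow> 'a \<Rightarrow> real) \<Rightarrow> ('a \<Rightarrow> 'a \<Rightarrow> real) \<Rightarrow> ennreal" where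
  "jump_size X \<mu> \<rho> = (SUP (x, y) \<in> {(x, y). adj X \<mu> x y}. ennreal (\<rho> x y))"

text \<open>By the triangle inequality, compatibility does not depend on the centre \<open>x\<^sub>0 \<in> X\<close> of the
  balls.\<close>

definition compatible_metric ::
  "'a set \<Rightarrow> ('a \<Rightarrow> 'a \<Rightarrow> real) \<Rightarrow> ('a \<Rightarrow> real) \<Rightarrow> ('a \<Rightarrow> 'a \<Rightarrow> real) \<Rightarrow> 'a \<Rightarrow> bool" where
  "compatible_metric X \<mu> m \<rho> x\<^sub>0 \<longleftrightarrow> pseudo_metric_on X \<rho> \<and> jump_size X \<mu> \<rho> < \<infinity> \<and>
     (\<forall>r\<ge>0. bdd_above (weighted_deg X \<mu> m ` metric_ball X \<rho> x\<^sub>0 r))"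

definition superharmonic ::
  "'a set \<Rightarrow> ('a \<Rightarrow> 'a \<Rightarrow> real) \<Rightarrow> ('a \<Rightarrow> real) \<Rightarrow> ('a \<Rightarrow> real) \<Rightarrow> bool" where
  "superharmonic X \<mu> m f \<longleftrightarrow> (\<forall>x\<in>X. (\<lambda>y. \<mu> x y * \<bar>f y\<bar>) summable_on X \<and>
     1 / m x * (\<Sum>\<^sub>\<infinity>y\<in>X. \<mu> x y * (f x - f y)) \<ge> 0)"

text \<open>Of the standard equivalent definitions of recurrence of a connected graph, this is the one
  by non-negative superharmonic functions. Divergence of \<open>\<Sum>n. P\<^sup>n x y\<close> would need a convention
  for the graph with a single vertex, whose total edge weight is \<open>0\<close> and for which the
  transition matrix is undefined.\<close>

definition recurrent_graph ::
  "'a set \<Rightarrow> ('a \<Rightarrow> 'a \<Rightarrow> real) \<Rightarrow> ('a \<Rightarrow> real) \<Rightarrow> bool" where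
  "recurrent_graph X \<mu> m \<longleftrightarrow>
     (\<forall>f. superharmonic X \<mu> m f \<and> (\<forall>x\<in>X. f x \<ge> 0) \<longrightarrow> f constant_on X)"

end

theory Submission
  imports Defs
begin

text \<open>
  Two facts combine. The first is potential-theoretic: a positive superharmonic function \<open>f\<close>
  satisfies
  \<open>(\<Sum>x y. \<mu> x y * (g x * f y - g y * f x)\<^sup>2 / (f x * f y)) \<le> (\<Sum>x y. \<mu> x y * (g x - g y)\<^sup>2)\<close>
  for every test function \<open>g\<close> for which \<open>\<Sum>x y. \<mu> x y * (g x)\<^sup>2\<close> is finite
  (\<open>superharmonic_caccioppoli\<close>). If a fixed edge \<open>x \<sim> y\<close> admits such \<open>g\<close> of arbitrarily small
  energy with \<open>g x = g y = 1\<close>, the term of that edge on the left forces \<open>f x = f y\<close>, and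
  connectedness makes \<open>f\<close> constant (\<open>recurrent_if_small_energy_cutoffs\<close>).

  The second is geometric: volume growth produces these test functions. Let \<open>V r\<close> be the measure
  of the ball \<open>B\<^sub>r\<close>. The cutoff that falls linearly from \<open>1\<close> to \<open>0\<close> as the distance to the root
  grows from \<open>R / 2\<close> to \<open>R\<close> has energy at most \<open>8 * V R / R\<^sup>2\<close>, because the metric is intrinsic
  (\<open>energy_cutoff_le\<close>). For the radii \<open>4 ^ k\<close> the annuli on which these cutoffs vary are so far
  apart that, once \<open>4 ^ k\<close> exceeds the jump size, no edge sees two of them. The energy of a convex
  combination with weights \<open>c k\<close> is therefore at most \<open>\<Sum>k. (c k)\<^sup>2 * 8 / w k\<close> with
  \<open>w k = 16 ^ k / V (4 ^ k)\<close>, as for resistors in series, and the choice of \<open>c k\<close> proportional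
  to \<open>w k\<close> brings it down to \<open>8 / (\<Sum>k. w k)\<close> (\<open>energy_multiscale_cutoff_le\<close>). Divergence of the
  integral of \<open>r / V r\<close> is divergence of the series of the \<open>w k\<close>
  (\<open>nonsummable_volume_growth\<close>), so this energy can be made as small as desired. The bound on the
  degree on balls enters only to guarantee that the cutoffs, whose supports may be infinite sets,
  have finite \<open>\<Sum>x y. \<mu> x y * (g x)\<^sup>2\<close>.

  Sums over vertices are written as \<open>[0, \<infinity>]\<close>-valued integrals over the counting measure, so that
  double sums can be rearranged without a check of summability.
\<close>

section \<open>Sums over countable sets as integrals\<close>

lemma nn_integral_count_space_eq_infsum:
  fixes f :: "'a \<Rightarrow> real"
  assumes summable: "f summable_on A" and nonneg: "\<And>x. x \<in> A \<Longrightarrow> 0 \<le> f x"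
  shows "(\<integral>\<^sup>+x. ennreal (f x) \<partial>count_space A) = ennreal (\<Sum>\<^sub>\<infinity>x\<in>A. f x)"
proof -
  have "Infinite_Set_Sum.abs_summable_on f A"
    using assms by (subst abs_summable_equivalent [symmetric])
      (metis summable_on_iff_abs_summable_on_real)
  then show ?thesis
    using nonneg by (simp add: nn_integral_conv_infsetsum infsetsum_infsum)
qed

lemma nn_integral_count_space_swap:
  fixes f :: "'a \<Rightarrow> 'b \<Rightarrow> ennreal"
  assumes "countable A" and "countable B"
  shows "(\<integral>\<^sup>+x. \<integral>\<^sup>+y. f x y \<partial>count_space B \<partial>count_space A)
       = (\<integral>\<^sup>+y. \<integral>\<^sup>+x. f x y \<partial>count_space A \<partial>count_space B)"
proof -
  interpret A: sigma_finite_measure "count_space A"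
    using assms by (intro sigma_finite_measure_count_space_countable)
  interpret B: sigma_finite_measure "count_space B"
    using assms by (intro sigma_finite_measure_count_space_countable)
  interpret pair_sigma_finite "count_space B" "count_space A" ..
  show ?thesis
    using assms by (intro Fubini') (auto simp: pair_measure_countable)
qed

section \<open>Energy and superharmonic functions\<close>

context weighted_graph
begin

lemma superharmonic_neighbour_sum_le:
  assumes f: "superharmonic X \<mu> m f" and nonneg: "\<And>y. y \<in> X \<Longrightarrow> 0 \<le> f y" and x: "x \<in> X"
  shows "(\<integral>\<^sup>+y. ennreal (\<mu> x y * f y) \<partial>count_space X)
       \<le> (\<integral>\<^sup>+y. ennreal (\<mu> x y * f x) \<partial>count_space X)"
proof -
  have "(\<lambda>y. \<mu> x y * \<bar>f y\<bar>) summable_on X"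
    using f x by (auto simp: superharmonic_def)
  then have s1: "(\<lambda>y. \<mu> x y * f y) summable_on X"
    by (rule summable_on_cong [THEN iffD1, rotated]) (use nonneg in auto)
  have s2: "(\<lambda>y. \<mu> x y * f x) summable_on X"
    by (intro summable_on_cmult_left \<mu>_summable x)
  have "0 \<le> 1 / m x * (\<Sum>\<^sub>\<infinity>y\<in>X. \<mu> x y * (f x - f y))"
    using f x by (auto simp: superharmonic_def)
  then have "0 \<le> (\<Sum>\<^sub>\<infinity>y\<in>X. \<mu> x y * f x - \<mu> x y * f y)"
    using m_pos [OF x] by (simp add: zero_le_divide_iff right_diff_distrib)
  also have "\<dots> = (\<Sum>\<^sub>\<infinity>y\<in>X. \<mu> x y * f x) - (\<Sum>\<^sub>\<infinity>y\<in>X. \<mu> x y * f y)"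
    using infsum_add [OF s2 summable_on_uminus [THEN iffD2, OF s1]] by (simp add: infsum_uminus)
  finally show ?thesis
    using s1 s2 x nonneg
    by (subst (1 2) nn_integral_count_space_eq_infsum) (auto simp: \<mu>_nonneg intro!: ennreal_leI)
qed

definition energy :: "('a \<Rightarrow> real) \<Rightarrow> ennreal" where
  "energy g = (\<integral>\<^sup>+x. \<integral>\<^sup>+y. ennreal (\<mu> x y * (g x - g y)\<^sup>2) \<partial>count_space X \<partial>count_space X)"

text \<open>
  Formally this is the inequality obtained by testing superharmonicity of \<open>f\<close> against
  \<open>g\<^sup>2 / f\<close> and summing by parts. Expanding the squares gives the pointwise identity
  \<open>(a * f y - b * f x)\<^sup>2 / (f x * f y) + a\<^sup>2 + b\<^sup>2 = (a - b)\<^sup>2 + a\<^sup>2 * f y / f x + b\<^sup>2 * f x / f y\<close>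
  with \<open>a = g x\<close>, \<open>b = g y\<close>. After summation, symmetry makes the two terms \<open>a\<^sup>2, b\<^sup>2\<close> equal, and
  likewise the two quotient terms, and superharmonicity bounds the latter by the former. The
  common part is finite by assumption and cancels.
\<close>

lemma superharmonic_caccioppoli:
  assumes f: "superharmonic X \<mu> m f" and pos: "\<And>x. x \<in> X \<Longrightarrow> 0 < f x"
    and fin: "(\<integral>\<^sup>+x. \<integral>\<^sup>+y. ennreal (\<mu> x y * (g x)\<^sup>2) \<partial>count_space X \<partial>count_space X) < \<infinity>"
  shows "(\<integral>\<^sup>+x. \<integral>\<^sup>+y. ennreal (\<mu> x y * (g x * f y - g y * f x)\<^sup>2 / (f x * f y))
            \<partial>count_space X \<partial>count_space X) \<le> energy g" (is "?S \<le> _")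
proof -
  let ?A = "\<integral>\<^sup>+x. \<integral>\<^sup>+y. ennreal (\<mu> x y * (g x)\<^sup>2) \<partial>count_space X \<partial>count_space X"
  let ?G = "\<integral>\<^sup>+x. \<integral>\<^sup>+y. ennreal (\<mu> x y * (g x)\<^sup>2 * f y / f x) \<partial>count_space X \<partial>count_space X"
  have A_swap: "?A = (\<integral>\<^sup>+x. \<integral>\<^sup>+y. ennreal (\<mu> x y * (g y)\<^sup>2) \<partial>count_space X \<partial>count_space X)"
    by (subst nn_integral_count_space_swap [OF countable_X countable_X])
       (auto intro!: nn_integral_cong simp: \<mu>_sym)
  have G_swap: "?G = (\<integral>\<^sup>+x. \<integral>\<^sup>+y. ennreal (\<mu> x y * (g y)\<^sup>2 * f x / f y) \<partial>count_space X \<partial>count_space X)"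
    by (subst nn_integral_count_space_swap [OF countable_X countable_X])
       (auto intro!: nn_integral_cong simp: \<mu>_sym)
  have "?G \<le> ?A"
  proof (rule nn_integral_mono)
    fix x assume "x \<in> space (count_space X)"
    then have x: "x \<in> X" by simp
    have "(\<integral>\<^sup>+y. ennreal (\<mu> x y * (g x)\<^sup>2 * f y / f x) \<partial>count_space X)
        = (\<integral>\<^sup>+y. ennreal ((g x)\<^sup>2 / f x) * ennreal (\<mu> x y * f y) \<partial>count_space X)"
      using pos [OF x] by (intro nn_integral_cong) (simp flip: ennreal_mult'' add: mult_ac)
    also have "\<dots> = ennreal ((g x)\<^sup>2 / f x) * (\<integral>\<^sup>+y. ennreal (\<mu> x y * f y) \<partial>count_space X)"
      by (simp add: nn_integral_cmult)
    also have "\<dots> \<le> ennreal ((g x)\<^sup>2 / f x) * (\<integral>\<^sup>+y. ennreal (\<mu> x y * f x) \<partial>count_space X)"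
      using f pos x by (intro mult_left_mono superharmonic_neighbour_sum_le) (auto simp: less_imp_le)
    also have "\<dots> = (\<integral>\<^sup>+y. ennreal ((g x)\<^sup>2 / f x) * ennreal (\<mu> x y * f x) \<partial>count_space X)"
      by (simp add: nn_integral_cmult)
    also have "\<dots> = (\<integral>\<^sup>+y. ennreal (\<mu> x y * (g x)\<^sup>2) \<partial>count_space X)"
      using pos [OF x] by (intro nn_integral_cong) (simp flip: ennreal_mult'' add: mult_ac)
    finally show "(\<integral>\<^sup>+y. ennreal (\<mu> x y * (g x)\<^sup>2 * f y / f x) \<partial>count_space X)
        \<le> (\<integral>\<^sup>+y. ennreal (\<mu> x y * (g x)\<^sup>2) \<partial>count_space X)" .
  qed
  \<comment> \<open>All terms of the identity are kept non-negative, so that it can be summed in \<open>[0, \<infinity>]\<close>.\<close>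
  have "?S + (?A + ?A) = (\<integral>\<^sup>+x. \<integral>\<^sup>+y. ennreal (\<mu> x y * (g x * f y - g y * f x)\<^sup>2 / (f x * f y))
      + (ennreal (\<mu> x y * (g x)\<^sup>2) + ennreal (\<mu> x y * (g y)\<^sup>2)) \<partial>count_space X \<partial>count_space X)"
    by (subst (2) A_swap) (simp add: nn_integral_add)
  also have "\<dots> = (\<integral>\<^sup>+x. \<integral>\<^sup>+y. ennreal (\<mu> x y * (g x - g y)\<^sup>2)
      + (ennreal (\<mu> x y * (g x)\<^sup>2 * f y / f x) + ennreal (\<mu> x y * (g y)\<^sup>2 * f x / f y))
      \<partial>count_space X \<partial>count_space X)"
  proof (intro nn_integral_cong)
    fix x y assume "x \<in> space (count_space X)" "y \<in> space (count_space X)"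
    then have x: "x \<in> X" and y: "y \<in> X" by auto
    note p = pos [OF x] pos [OF y]
    have "\<mu> x y * (g x * f y - g y * f x)\<^sup>2 / (f x * f y) + (\<mu> x y * (g x)\<^sup>2 + \<mu> x y * (g y)\<^sup>2)
        = \<mu> x y * (g x - g y)\<^sup>2 + (\<mu> x y * (g x)\<^sup>2 * f y / f x + \<mu> x y * (g y)\<^sup>2 * f x / f y)"
      using p by (simp add: divide_simps) (simp add: power2_eq_square algebra_simps)
    then show "ennreal (\<mu> x y * (g x * f y - g y * f x)\<^sup>2 / (f x * f y))
      + (ennreal (\<mu> x y * (g x)\<^sup>2) + ennreal (\<mu> x y * (g y)\<^sup>2))
      = ennreal (\<mu> x y * (g x - g y)\<^sup>2)
      + (ennreal (\<mu> x y * (g x)\<^sup>2 * f y / f x) + ennreal (\<mu> x y * (g y)\<^sup>2 * f x / f y))"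
      using p \<mu>_nonneg [OF x y] by (simp flip: ennreal_plus)
  qed
  also have "\<dots> = energy g + (?G + ?G)"
    unfolding energy_def by (subst (2) G_swap) (simp add: nn_integral_add)
  also have "\<dots> \<le> energy g + (?A + ?A)"
    using \<open>?G \<le> ?A\<close> by (intro add_mono order_refl)
  finally show ?thesis
    using fin by (auto simp: ennreal_add_left_cancel_le add.commute [of _ "?A + ?A"])
qed

text \<open>
  The hypothesis is a form of vanishing capacity. Adding \<open>1\<close> to a non-negative superharmonic
  function keeps it superharmonic and makes it positive, so that it may stand in a denominator.
\<close>

lemma recurrent_if_small_energy_cutoffs:
  assumes conn: "connected_graph X \<mu>"
    and cutoff: "\<And>x y \<epsilon>. \<lbrakk>x \<in> X; y \<in> X; 0 < \<epsilon>\<rbrakk> \<Longrightarrow> \<exists>g. g x = 1 \<and> g y = 1 \<and>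
      (\<integral>\<^sup>+x. \<integral>\<^sup>+y. ennreal (\<mu> x y * (g x)\<^sup>2) \<partial>count_space X \<partial>count_space X) < \<infinity> \<and>
      energy g \<le> ennreal \<epsilon>"
  shows "recurrent_graph X \<mu> m"
  unfolding recurrent_graph_def
proof (intro allI impI, elim conjE)
  fix f assume f: "superharmonic X \<mu> m f" and nonneg: "\<forall>x\<in>X. 0 \<le> f x"
  define h where "h x = f x + 1" for x
  have h_pos: "0 < h x" if "x \<in> X" for x
    using nonneg that by (auto simp: h_def intro: add_nonneg_pos)
  have h: "superharmonic X \<mu> m h"
    unfolding superharmonic_def
  proof (intro ballI conjI)
    fix x assume x: "x \<in> X"
    have "(\<lambda>y. \<mu> x y * \<bar>f y\<bar> + \<mu> x y) summable_on X"
      using f x by (intro summable_on_add \<mu>_summable) (auto simp: superharmonic_def)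
    then show "(\<lambda>y. \<mu> x y * \<bar>h y\<bar>) summable_on X"
      by (rule summable_on_cong [THEN iffD1, rotated])
         (use nonneg in \<open>auto simp: h_def abs_of_nonneg algebra_simps\<close>)
    show "1 / m x * (\<Sum>\<^sub>\<infinity>y\<in>X. \<mu> x y * (h x - h y)) \<ge> 0"
      using f x by (simp add: superharmonic_def h_def)
  qed
  have step: "f x = f y" if "adj X \<mu> x y" for x y
  proof (rule ccontr)
    assume ne: "f x \<noteq> f y"
    have x: "x \<in> X" and y: "y \<in> X" and "\<mu> x y > 0"
      using that by (auto simp: adj_def)
    define \<delta> where "\<delta> = \<mu> x y * (h y - h x)\<^sup>2 / (h x * h y)"
    have "\<delta> > 0"
      using \<open>\<mu> x y > 0\<close> ne h_pos x y by (auto simp: \<delta>_def h_def)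
    then obtain g where g: "g x = 1" "g y = 1"
        "(\<integral>\<^sup>+x. \<integral>\<^sup>+y. ennreal (\<mu> x y * (g x)\<^sup>2) \<partial>count_space X \<partial>count_space X) < \<infinity>"
        "energy g \<le> ennreal (\<delta> / 2)"
      using cutoff [OF x y, of "\<delta> / 2"] by auto
    let ?t = "\<lambda>x y. ennreal (\<mu> x y * (g x * h y - g y * h x)\<^sup>2 / (h x * h y))"
    have "ennreal \<delta> = ?t x y"
      by (simp add: \<delta>_def g)
    also have "\<dots> \<le> (\<integral>\<^sup>+y. ?t x y \<partial>count_space X)"
      using y by (intro nn_integral_ge_point)
    also have "\<dots> \<le> (\<integral>\<^sup>+x. \<integral>\<^sup>+y. ?t x y \<partial>count_space X \<partial>count_space X)"
      using x by (intro nn_integral_ge_point [where p = "\<lambda>x. \<integral>\<^sup>+y. ?t x y \<partial>count_space X"])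
    also have "\<dots> \<le> ennreal (\<delta> / 2)"
      using superharmonic_caccioppoli [OF h h_pos g(3)] g(4) by (rule order_trans)
    finally show False
      using \<open>\<delta> > 0\<close> by simp
  qed
  have "f x = f y" if "(adj X \<mu>)\<^sup>*\<^sup>* x y" for x y
    using that by induction (auto dest: step)
  then show "f constant_on X"
    using conn unfolding connected_graph_def constant_on_def by metis
qed

text \<open>
  Energies add up when no edge sees the variation of two of the functions: the cross terms of the
  square of the sum then vanish.
\<close>

lemma energy_sum_disjoint:
  assumes I: "finite I"
    and disjoint: "\<And>i j x y. \<lbrakk>i \<in> I; j \<in> I; i \<noteq> j; adj X \<mu> x y\<rbrakk>
      \<Longrightarrow> (u i x - u i y) * (u j x - u j y) = 0"
  shows "energy (\<lambda>x. \<Sum>i\<in>I. c i * u i x) = (\<Sum>i\<in>I. ennreal ((c i)\<^sup>2) * energy (u i))"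
proof -
  have "energy (\<lambda>x. \<Sum>i\<in>I. c i * u i x) = (\<integral>\<^sup>+x. \<integral>\<^sup>+y.
      (\<Sum>i\<in>I. ennreal ((c i)\<^sup>2) * ennreal (\<mu> x y * (u i x - u i y)\<^sup>2)) \<partial>count_space X \<partial>count_space X)"
    unfolding energy_def
  proof (intro nn_integral_cong)
    fix x y assume "x \<in> space (count_space X)" "y \<in> space (count_space X)"
    then have x: "x \<in> X" and y: "y \<in> X" by auto
    have "\<mu> x y * ((\<Sum>i\<in>I. c i * u i x) - (\<Sum>i\<in>I. c i * u i y))\<^sup>2
        = \<mu> x y * (\<Sum>i\<in>I. (c i)\<^sup>2 * (u i x - u i y)\<^sup>2)"
    proof (cases "adj X \<mu> x y")
      case True
      have "((\<Sum>i\<in>I. c i * u i x) - (\<Sum>i\<in>I. c i * u i y))\<^sup>2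
          = (\<Sum>i\<in>I. \<Sum>j\<in>I. c i * c j * ((u i x - u i y) * (u j x - u j y)))"
        by (simp add: power2_eq_square sum_product algebra_simps flip: sum_subtractf)
      also have "\<dots> = (\<Sum>i\<in>I. \<Sum>j\<in>I. if i = j then (c i)\<^sup>2 * (u i x - u i y)\<^sup>2 else 0)"
        using disjoint [OF _ _ _ True] by (intro sum.cong refl) (auto simp: power2_eq_square)
      finally show ?thesis
        using I by simp
    next
      case False
      then show ?thesis
        using \<mu>_nonneg [OF x y] x y by (auto simp: adj_def)
    qed
    then show "ennreal (\<mu> x y * ((\<Sum>i\<in>I. c i * u i x) - (\<Sum>i\<in>I. c i * u i y))\<^sup>2)
        = (\<Sum>i\<in>I. ennreal ((c i)\<^sup>2) * ennreal (\<mu> x y * (u i x - u i y)\<^sup>2))"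
      using \<mu>_nonneg [OF x y]
      by (simp add: sum_distrib_left mult_ac flip: ennreal_mult')
  qed
  also have "\<dots> = (\<Sum>i\<in>I. ennreal ((c i)\<^sup>2) * energy (u i))"
    unfolding energy_def by (simp add: nn_integral_sum nn_integral_cmult)
  finally show ?thesis .
qed

lemma emeasure_vertex_measure:
  assumes "B \<subseteq> X"
  shows "emeasure (vertex_measure X m) B = (\<integral>\<^sup>+x. ennreal (m x) * indicator B x \<partial>count_space X)"
  using assms unfolding vertex_measure_def point_measure_def by (subst emeasure_density) auto

end

section \<open>Cutoffs from an intrinsic metric\<close>

locale rooted_intrinsic_graph = weighted_graph +
  fixes \<rho> :: "'a \<Rightarrow> 'a \<Rightarrow> real" and x\<^sub>0 :: 'a
  assumes intrinsic: "intrinsic_metric X \<mu> m \<rho>" and root: "x\<^sub>0 \<in> X"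
begin

abbreviation ball_volume :: "real \<Rightarrow> ennreal" where
  "ball_volume r \<equiv> emeasure (vertex_measure X m) (metric_ball X \<rho> x\<^sub>0 r)"

definition cutoff :: "real \<Rightarrow> 'a \<Rightarrow> real" where
  "cutoff R x = max 0 (min 1 (2 - 2 * \<rho> x x\<^sub>0 / R))"

lemma dist_nonneg: "x \<in> X \<Longrightarrow> y \<in> X \<Longrightarrow> 0 \<le> \<rho> x y"
  and dist_sym: "x \<in> X \<Longrightarrow> y \<in> X \<Longrightarrow> \<rho> x y = \<rho> y x"
  and dist_triangle: "x \<in> X \<Longrightarrow> y \<in> X \<Longrightarrow> z \<in> X \<Longrightarrow> \<rho> x z \<le> \<rho> x y + \<rho> y z"
  and dist_root: "\<rho> x\<^sub>0 x\<^sub>0 = 0"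
  using intrinsic root by (auto simp: intrinsic_metric_def pseudo_metric_on_def)

lemma intrinsic_sum_le:
  assumes "x \<in> X"
  shows "(\<integral>\<^sup>+y. ennreal (\<mu> x y * (\<rho> x y)\<^sup>2) \<partial>count_space X) \<le> ennreal (m x)"
  using assms intrinsic
  by (subst nn_integral_count_space_eq_infsum) (auto simp: intrinsic_metric_def \<mu>_nonneg intro!: ennreal_leI)

lemma mono_ball_volume: "mono ball_volume"
  by (intro monoI emeasure_mono) (auto simp: metric_ball_def vertex_measure_def sets_point_measure)

lemma ball_volume_pos:
  assumes "0 \<le> r"
  shows "0 < ball_volume r"
proof -
  have "ennreal (m x\<^sub>0) = ennreal (m x\<^sub>0) * indicator (metric_ball X \<rho> x\<^sub>0 r) x\<^sub>0"
    using assms root dist_root by (simp add: metric_ball_def)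
  also have "\<dots> \<le> ball_volume r"
    using root by (subst emeasure_vertex_measure)
      (auto simp: metric_ball_def intro!: nn_integral_ge_point [where p = "\<lambda>x. ennreal (m x) * _ x"])
  finally show ?thesis
    using m_pos [OF root] by (metis ennreal_less_zero_iff less_le_trans)
qed

lemma cutoff_eq_1: "0 < R \<Longrightarrow> 2 * \<rho> x x\<^sub>0 \<le> R \<Longrightarrow> cutoff R x = 1"
  by (simp add: cutoff_def field_simps)

lemma cutoff_eq_0: "0 < R \<Longrightarrow> R \<le> \<rho> x x\<^sub>0 \<Longrightarrow> cutoff R x = 0"
  by (simp add: cutoff_def field_simps)

lemma cutoff_bounds: "0 \<le> cutoff R x" "cutoff R x \<le> 1"
  by (auto simp: cutoff_def)

lemma cutoff_lipschitz:
  assumes "0 < R" "x \<in> X" "y \<in> X"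
  shows "\<bar>cutoff R x - cutoff R y\<bar> \<le> 2 / R * \<rho> x y"
proof -
  have "\<bar>\<rho> x x\<^sub>0 - \<rho> y x\<^sub>0\<bar> \<le> \<rho> x y"
    using dist_triangle [of x y x\<^sub>0] dist_triangle [of y x x\<^sub>0] dist_sym [of x y] assms root by auto
  then have "2 / R * \<bar>\<rho> x x\<^sub>0 - \<rho> y x\<^sub>0\<bar> \<le> 2 / R * \<rho> x y"
    using \<open>0 < R\<close> by (intro mult_left_mono) auto
  moreover have "\<bar>cutoff R x - cutoff R y\<bar> \<le> \<bar>2 * \<rho> x x\<^sub>0 / R - 2 * \<rho> y x\<^sub>0 / R\<bar>"
    by (auto simp: cutoff_def)
  moreover have "\<bar>2 * \<rho> x x\<^sub>0 / R - 2 * \<rho> y x\<^sub>0 / R\<bar> = 2 / R * \<bar>\<rho> x x\<^sub>0 - \<rho> y x\<^sub>0\<bar>"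
    using \<open>0 < R\<close> by (simp add: abs_if field_simps)
  ultimately show ?thesis by linarith
qed

text \<open>
  An edge contributes only if one of its ends lies in the ball of radius \<open>R\<close>. The Lipschitz bound
  turns its contribution into \<open>(2 / R)\<^sup>2 * \<mu> x y * (\<rho> x y)\<^sup>2\<close>, whose sum over \<open>y\<close> is at most
  \<open>(2 / R)\<^sup>2 * m x\<close> as the metric is intrinsic. Each end of the edge gives one such sum over the
  ball, hence the factor \<open>8\<close>.
\<close>

lemma energy_cutoff_le:
  assumes R: "0 < R"
  shows "energy (cutoff R) \<le> ennreal (8 / R\<^sup>2) * ball_volume R"
proof -
  let ?B = "metric_ball X \<rho> x\<^sub>0 R"
  let ?T = "\<integral>\<^sup>+x. \<integral>\<^sup>+y. ennreal (\<mu> x y * (\<rho> x y)\<^sup>2) * indicator ?B x \<partial>count_space X \<partial>count_space X"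
  have T_swap: "?T = (\<integral>\<^sup>+x. \<integral>\<^sup>+y. ennreal (\<mu> x y * (\<rho> x y)\<^sup>2) * indicator ?B y
      \<partial>count_space X \<partial>count_space X)"
    by (subst nn_integral_count_space_swap [OF countable_X countable_X])
       (auto intro!: nn_integral_cong simp: \<mu>_sym dist_sym)
  have "?T \<le> ball_volume R"
    by (subst emeasure_vertex_measure)
       (auto simp: metric_ball_def nn_integral_multc intro!: nn_integral_mono mult_right_mono intrinsic_sum_le)
  have "energy (cutoff R) \<le> (\<integral>\<^sup>+x. \<integral>\<^sup>+y. ennreal (4 / R\<^sup>2) *
      (ennreal (\<mu> x y * (\<rho> x y)\<^sup>2) * indicator ?B x + ennreal (\<mu> x y * (\<rho> x y)\<^sup>2) * indicator ?B y)
      \<partial>count_space X \<partial>count_space X)"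
    unfolding energy_def
  proof (intro nn_integral_mono)
    fix x y assume "x \<in> space (count_space X)" "y \<in> space (count_space X)"
    then have x: "x \<in> X" and y: "y \<in> X" by auto
    show "ennreal (\<mu> x y * (cutoff R x - cutoff R y)\<^sup>2) \<le> ennreal (4 / R\<^sup>2) *
      (ennreal (\<mu> x y * (\<rho> x y)\<^sup>2) * indicator ?B x + ennreal (\<mu> x y * (\<rho> x y)\<^sup>2) * indicator ?B y)"
    proof (cases "x \<in> ?B \<or> y \<in> ?B")
      case True
      have "(cutoff R x - cutoff R y)\<^sup>2 \<le> (2 / R * \<rho> x y)\<^sup>2"
        using cutoff_lipschitz [OF R x y] by (intro power2_le_iff_abs_le [THEN iffD2]) (use R dist_nonneg x y in auto)
      then have "\<mu> x y * (cutoff R x - cutoff R y)\<^sup>2 \<le> \<mu> x y * (2 / R * \<rho> x y)\<^sup>2"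
        using \<mu>_nonneg [OF x y] by (rule mult_left_mono)
      also have "\<dots> = 4 / R\<^sup>2 * (\<mu> x y * (\<rho> x y)\<^sup>2)"
        by (simp add: power_mult_distrib power_divide)
      finally have "ennreal (\<mu> x y * (cutoff R x - cutoff R y)\<^sup>2)
          \<le> ennreal (4 / R\<^sup>2) * ennreal (\<mu> x y * (\<rho> x y)\<^sup>2)"
        by (simp flip: ennreal_mult' add: ennreal_leI)
      also have "\<dots> \<le> ennreal (4 / R\<^sup>2) *
      (ennreal (\<mu> x y * (\<rho> x y)\<^sup>2) * indicator ?B x + ennreal (\<mu> x y * (\<rho> x y)\<^sup>2) * indicator ?B y)"
        using True by (intro mult_left_mono) (auto simp: indicator_def)
      finally show ?thesis .
    next
      case False
      then have "cutoff R x = 0" "cutoff R y = 0"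
        using x y R by (auto simp: metric_ball_def intro!: cutoff_eq_0)
      then show ?thesis by simp
    qed
  qed
  also have "\<dots> = ennreal (4 / R\<^sup>2) * (?T + ?T)"
    by (subst (2) T_swap) (simp add: nn_integral_cmult nn_integral_add)
  also have "\<dots> \<le> ennreal (4 / R\<^sup>2) * (ball_volume R + ball_volume R)"
    using \<open>?T \<le> ball_volume R\<close> by (intro mult_left_mono add_mono) auto
  also have "\<dots> = ennreal (8 / R\<^sup>2) * ball_volume R"
  proof -
    have "ennreal (8 / R\<^sup>2) = ennreal (4 / R\<^sup>2) + ennreal (4 / R\<^sup>2)"
      by (simp flip: ennreal_plus)
    then show ?thesis
      by (simp add: distrib_left distrib_right)
  qed
  finally show ?thesis .
qed

text \<open>
  The cutoff of radius \<open>4 ^ i\<close> is constant on the edge unless one end has distance less than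
  \<open>4 ^ i\<close> from the root. The other end then has distance less than \<open>2 * 4 ^ i\<close>, which is at most
  half of \<open>4 ^ j\<close>, so the larger cutoff is \<open>1\<close> at both ends.
\<close>

lemma cutoff_scales_disjoint:
  assumes "i < j" and jump: "\<rho> x y \<le> 4 ^ i" and x: "x \<in> X" and y: "y \<in> X"
  shows "(cutoff (4 ^ i) x - cutoff (4 ^ i) y) * (cutoff (4 ^ j) x - cutoff (4 ^ j) y) = 0"
proof (cases "\<rho> x x\<^sub>0 < 4 ^ i \<or> \<rho> y x\<^sub>0 < 4 ^ i")
  case True
  have "\<bar>\<rho> x x\<^sub>0 - \<rho> y x\<^sub>0\<bar> \<le> 4 ^ i"
    using dist_triangle [of x y x\<^sub>0] dist_triangle [of y x x\<^sub>0] dist_sym [of x y] assms root by auto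
  moreover have "(4::real) * 4 ^ i \<le> 4 ^ j"
    using \<open>i < j\<close> power_increasing [of "Suc i" j "4::real"] by simp
  ultimately have "cutoff (4 ^ j) x = 1" "cutoff (4 ^ j) y = 1"
    using True by (auto intro!: cutoff_eq_1)
  then show ?thesis by simp
next
  case False
  then show ?thesis by (simp add: cutoff_eq_0)
qed

text \<open>
  The weights \<open>w k / S\<close> minimise \<open>\<Sum>k. (c k)\<^sup>2 * (8 / w k)\<close> subject to \<open>(\<Sum>k. c k) = 1\<close>, where
  \<open>8 / w k\<close> is the energy bound for the cutoff of radius \<open>4 ^ k\<close>.
\<close>

lemma energy_multiscale_cutoff_le:
  assumes jump: "\<And>x y. adj X \<mu> x y \<Longrightarrow> \<rho> x y \<le> 4 ^ K"
    and fin: "\<And>r. ball_volume r < \<infinity>"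
  defines "w \<equiv> \<lambda>k. 16 ^ k / enn2real (ball_volume (4 ^ k))"
  assumes S: "S = (\<Sum>k\<in>{K..<N}. w k)" and S_pos: "0 < S"
  shows "energy (\<lambda>x. \<Sum>k\<in>{K..<N}. w k / S * cutoff (4 ^ k) x) \<le> ennreal (8 / S)"
proof -
  have vol: "ball_volume (4 ^ k) = ennreal (16 ^ k / w k) \<and> 0 < w k" for k
    using ball_volume_pos [of "4 ^ k"] fin [of "4 ^ k"]
    by (cases "ball_volume (4 ^ k)") (auto simp: w_def)
  have "energy (\<lambda>x. \<Sum>k\<in>{K..<N}. w k / S * cutoff (4 ^ k) x)
      = (\<Sum>k\<in>{K..<N}. ennreal ((w k / S)\<^sup>2) * energy (cutoff (4 ^ k)))"
  proof (rule energy_sum_disjoint)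
    fix i j x y
    assume ij: "i \<in> {K..<N}" "j \<in> {K..<N}" "i \<noteq> j" and xy: "adj X \<mu> x y"
    then have "x \<in> X" "y \<in> X" by (auto simp: adj_def)
    have "\<rho> x y \<le> 4 ^ k" if "K \<le> k" for k
      using jump [OF xy] power_increasing [OF that, of "4::real"] by linarith
    with ij cutoff_scales_disjoint [of i j x y] cutoff_scales_disjoint [of j i x y] \<open>x \<in> X\<close> \<open>y \<in> X\<close>
    show "(cutoff (4 ^ i) x - cutoff (4 ^ i) y) * (cutoff (4 ^ j) x - cutoff (4 ^ j) y) = 0"
      by (cases "i < j") (auto simp: mult.commute)
  qed simp
  also have "\<dots> \<le> (\<Sum>k\<in>{K..<N}. ennreal (8 / S\<^sup>2 * w k))"
  proof (rule sum_mono)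
    fix k
    have "energy (cutoff (4 ^ k)) \<le> ennreal (8 / (4 ^ k)\<^sup>2) * ennreal (16 ^ k / w k)"
      using energy_cutoff_le [of "4 ^ k"] vol [of k] by simp
    also have "\<dots> = ennreal (8 / w k)"
      using vol [of k] by (simp flip: ennreal_mult' power_mult add: power_mult mult.commute [of k])
    finally have "ennreal ((w k / S)\<^sup>2) * energy (cutoff (4 ^ k)) \<le> ennreal ((w k / S)\<^sup>2) * ennreal (8 / w k)"
      by (rule mult_left_mono) simp
    also have "\<dots> = ennreal (8 / S\<^sup>2 * w k)"
      using vol [of k] S_pos by (simp flip: ennreal_mult' add: power2_eq_square)
    finally show "ennreal ((w k / S)\<^sup>2) * energy (cutoff (4 ^ k)) \<le> ennreal (8 / S\<^sup>2 * w k)" .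
  qed
  also have "\<dots> = ennreal (8 / S\<^sup>2 * S)"
    using vol S_pos by (subst sum_ennreal) (auto simp: less_imp_le S sum_distrib_left)
  also have "8 / S\<^sup>2 * S = 8 / S"
    using S_pos by (simp add: power2_eq_square)
  finally show ?thesis .
qed

text \<open>
  A vertex \<open>x\<close> of the ball contributes at most \<open>(\<Sum>y. \<mu> x y)\<close>, which is \<open>m x\<close> times its degree; the
  bound is the supremum of the degree on the ball times the volume of the ball.
\<close>

lemma finite_mass_if_supported_in_ball:
  assumes deg: "bdd_above (weighted_deg X \<mu> m ` metric_ball X \<rho> x\<^sub>0 R)"
    and fin: "ball_volume R < \<infinity>"
    and supp: "\<And>x. x \<in> X \<Longrightarrow> x \<notin> metric_ball X \<rho> x\<^sub>0 R \<Longrightarrow> g x = 0"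
    and bound: "\<And>x. 0 \<le> g x \<and> g x \<le> 1"
  shows "(\<integral>\<^sup>+x. \<integral>\<^sup>+y. ennreal (\<mu> x y * (g x)\<^sup>2) \<partial>count_space X \<partial>count_space X) < \<infinity>"
proof -
  let ?B = "metric_ball X \<rho> x\<^sub>0 R"
  obtain D where D: "weighted_deg X \<mu> m x \<le> D" if "x \<in> ?B" for x
    using deg by (auto simp: bdd_above_def)
  have "(\<integral>\<^sup>+x. \<integral>\<^sup>+y. ennreal (\<mu> x y * (g x)\<^sup>2) \<partial>count_space X \<partial>count_space X)
      \<le> (\<integral>\<^sup>+x. ennreal D * (ennreal (m x) * indicator ?B x) \<partial>count_space X)"
  proof (rule nn_integral_mono)
    fix x assume "x \<in> space (count_space X)"
    then have x: "x \<in> X" by simp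
    show "(\<integral>\<^sup>+y. ennreal (\<mu> x y * (g x)\<^sup>2) \<partial>count_space X)
        \<le> ennreal D * (ennreal (m x) * indicator ?B x)"
    proof (cases "x \<in> ?B")
      case True
      have "(g x)\<^sup>2 \<le> 1"
        using bound [of x] by (simp add: power_le_one)
      then have "(\<integral>\<^sup>+y. ennreal (\<mu> x y * (g x)\<^sup>2) \<partial>count_space X) \<le> (\<integral>\<^sup>+y. ennreal (\<mu> x y) \<partial>count_space X)"
        using x by (intro nn_integral_mono ennreal_leI) (auto intro!: mult_left_le \<mu>_nonneg)
      also have "\<dots> = ennreal (\<Sum>\<^sub>\<infinity>y\<in>X. \<mu> x y)"
        using x by (intro nn_integral_count_space_eq_infsum \<mu>_summable \<mu>_nonneg)
      also have "(\<Sum>\<^sub>\<infinity>y\<in>X. \<mu> x y) \<le> D * m x"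
        using D [OF True] m_pos [OF x] by (simp add: weighted_deg_def field_simps)
      then have "ennreal (\<Sum>\<^sub>\<infinity>y\<in>X. \<mu> x y) \<le> ennreal D * ennreal (m x)"
        using m_pos [OF x] by (simp flip: ennreal_mult'' add: ennreal_leI)
      finally show ?thesis
        using True by simp
    qed (use supp x in simp)
  qed
  also have "\<dots> = ennreal D * ball_volume R"
    by (subst emeasure_vertex_measure) (auto simp: nn_integral_cmult metric_ball_def)
  also have "\<dots> < \<infinity>"
    using fin by (simp add: ennreal_mult_less_top)
  finally show ?thesis .
qed

end

section \<open>Volume growth\<close>

lemma ennreal_inverse_antimono: "a \<le> b \<Longrightarrow> inverse b \<le> inverse a" for a b :: ennreal
  by (simp add: less_eq_ennreal.rep_eq inverse_ennreal.rep_eq ereal_inverse_antimono)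

text \<open>
  On \<open>[4 ^ k, 4 ^ (k + 1))\<close> the integrand is at most \<open>4 * 4 ^ k / V (4 ^ k)\<close> and the interval has
  length \<open>3 * 4 ^ k\<close>, so the integral is at most twelve times the series.
\<close>

lemma volume_growth_series_eq_infinity:
  fixes V :: "real \<Rightarrow> ennreal"
  assumes mono: "mono V"
    and div: "(\<integral>\<^sup>+r\<in>{1..}. (ennreal r / V r) \<partial>lborel) = \<infinity>"
  shows "(\<Sum>k. ennreal (16 ^ k) / V (4 ^ k)) = \<infinity>"
proof -
  let ?I = "\<lambda>k. {4 ^ k ..< 4 * 4 ^ k :: real}"
  have "\<infinity> \<le> (\<integral>\<^sup>+r. (\<Sum>k. ennreal (4 * 4 ^ k) / V (4 ^ k) * indicator (?I k) r) \<partial>lborel)"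
    unfolding div [symmetric]
  proof (intro nn_integral_mono)
    fix r :: real
    show "ennreal r / V r * indicator {1..} r
        \<le> (\<Sum>k. ennreal (4 * 4 ^ k) / V (4 ^ k) * indicator (?I k) r)"
    proof (cases "1 \<le> r")
      case True
      obtain k where k: "r \<in> ?I k"
      proof -
        obtain n where n: "r < 4 ^ n"
          using real_arch_pow [of 4 r] by auto
        define l where "l = (LEAST n. r < 4 ^ n)"
        have l: "r < 4 ^ l"
          unfolding l_def using n by (rule LeastI)
        with True obtain k where k: "l = Suc k"
          by (cases l) auto
        have "\<not> r < 4 ^ k"
          unfolding l_def using k by (intro not_less_Least) (auto simp: l_def)
        then show ?thesis
          using l k by (intro that [of k]) auto
      qed
      have "ennreal r / V r \<le> ennreal (4 * 4 ^ k) / V (4 ^ k)"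
        using k monoD [OF mono, of "4 ^ k" r] unfolding divide_ennreal_def
        by (intro mult_mono ennreal_leI ennreal_inverse_antimono) auto
      also have "\<dots> = (\<Sum>j\<in>{k}. ennreal (4 * 4 ^ j) / V (4 ^ j) * indicator (?I j) r)"
        using k by simp
      also have "\<dots> \<le> (\<Sum>k. ennreal (4 * 4 ^ k) / V (4 ^ k) * indicator (?I k) r)"
        by (intro sum_le_suminf) auto
      finally show ?thesis
        using True by simp
    qed simp
  qed
  also have "\<dots> = (\<Sum>k. ennreal (4 * 4 ^ k) / V (4 ^ k) * ennreal (3 * 4 ^ k))"
    by (subst nn_integral_suminf) (auto simp: nn_integral_cmult_indicator intro!: suminf_cong)
  also have "\<dots> = (\<Sum>k. 12 * (ennreal (16 ^ k) / V (4 ^ k)))"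
  proof (intro suminf_cong)
    fix k :: nat
    have "(4::real) ^ k * 4 ^ k = 16 ^ k"
      by (simp flip: power_mult_distrib)
    then have "ennreal (4 * 4 ^ k) * ennreal (3 * 4 ^ k) = 12 * ennreal (16 ^ k)"
      by (subst ennreal_numeral [symmetric], subst (1 2) ennreal_mult' [symmetric]) (auto simp: mult_ac)
    then show "ennreal (4 * 4 ^ k) / V (4 ^ k) * ennreal (3 * 4 ^ k) = 12 * (ennreal (16 ^ k) / V (4 ^ k))"
      by (simp add: divide_ennreal_def) (metis mult.assoc mult.commute)
  qed
  also have "\<dots> = 12 * (\<Sum>k. ennreal (16 ^ k) / V (4 ^ k))"
    by simp
  finally show ?thesis
    by (simp add: ennreal_mult_eq_top_iff top_unique)
qed

text \<open>
  If some \<open>V r\<close> were infinite, only finitely many terms of the series would be non-zero, each of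
  them finite, and the series could not diverge.
\<close>

lemma nonsummable_volume_growth:
  fixes V :: "real \<Rightarrow> ennreal"
  assumes mono: "mono V" and pos: "0 < V 1"
    and div: "(\<integral>\<^sup>+r\<in>{1..}. (ennreal r / V r) \<partial>lborel) = \<infinity>"
  shows "V r < \<infinity>" and "\<not> summable (\<lambda>k. 16 ^ k / enn2real (V (4 ^ k)))"
proof -
  let ?a = "\<lambda>k. ennreal (16 ^ k) / V (4 ^ k)"
  note diverges = volume_growth_series_eq_infinity [OF mono div]
  have V_pos: "0 < V (4 ^ k)" for k
    using pos monoD [OF mono, of 1 "4 ^ k"] by (auto intro: less_le_trans)
  have a_finite: "?a k < \<infinity>" for k
    using V_pos [of k] by (auto simp: ennreal_divide_eq_top_iff simp flip: top.not_eq_extremum)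
  have finite: "V r < \<infinity>" for r
  proof (rule ccontr)
    assume "\<not> V r < \<infinity>"
    then have "V r = \<infinity>" by (simp flip: top.not_eq_extremum)
    obtain n where "r < 4 ^ n"
      using real_arch_pow [of 4 r] by auto
    have "?a k = 0" if "k \<ge> n" for k
    proof -
      have "r \<le> 4 ^ k"
        using \<open>r < 4 ^ n\<close> power_increasing [OF that, of "4::real"] by linarith
      then have "V (4 ^ k) = \<infinity>"
        using monoD [OF mono] \<open>V r = \<infinity>\<close> by (metis infinity_ennreal_def top_unique)
      then show ?thesis by simp
    qed
    then have "(\<Sum>k. ?a k) = (\<Sum>k\<in>{..<n}. ?a k)"
      by (intro suminf_finite) auto
    also have "\<dots> < \<infinity>"
      using a_finite by simp
    finally show False
      using diverges by simp
  qed
  show "V r < \<infinity>" by (rule finite)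
  have a_eq: "?a k = ennreal (16 ^ k / enn2real (V (4 ^ k)))" for k
    using V_pos [of k] finite [of "4 ^ k"]
    by (cases "V (4 ^ k)") (auto simp: divide_ennreal)
  show "\<not> summable (\<lambda>k. 16 ^ k / enn2real (V (4 ^ k)))"
    using diverges by (auto simp: a_eq suminf_ennreal2)
qed

section \<open>Recurrence\<close>

theorem corollary1p6:
  fixes X :: "'a set" and \<mu> :: "'a \<Rightarrow> 'a \<Rightarrow> real" and m :: "'a \<Rightarrow> real"
    and \<rho> :: "'a \<Rightarrow> 'a \<Rightarrow> real" and x\<^sub>0 :: 'a
  assumes "weighted_graph X \<mu> m"
    and "connected_graph X \<mu>"
    and "x\<^sub>0 \<in> X"
    and "intrinsic_metric X \<mu> m \<rho>"
    and "compatible_metric X \<mu> m \<rho> x\<^sub>0"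
    and "(\<integral>\<^sup>+ r\<in>{1..}. (ennreal r / emeasure (vertex_measure X m) (metric_ball X \<rho> x\<^sub>0 r)) \<partial>lborel) = \<infinity>"
  shows "recurrent_graph X \<mu> m"
proof -
  interpret weighted_graph X \<mu> m by fact
  interpret rooted_intrinsic_graph X \<mu> m \<rho> x\<^sub>0 by unfold_locales fact+
  define w where "w k = 16 ^ k / enn2real (ball_volume (4 ^ k))" for k
  have vol_finite: "ball_volume r < \<infinity>" for r
    using mono_ball_volume ball_volume_pos assms(6) by (intro nonsummable_volume_growth) auto
  have "\<not> summable w"
    unfolding w_def using mono_ball_volume ball_volume_pos assms(6)
    by (intro nonsummable_volume_growth) auto
  have w_nonneg: "0 \<le> w k" for k
    by (simp add: w_def)
  obtain s where s: "\<And>x y. adj X \<mu> x y \<Longrightarrow> \<rho> x y \<le> s"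
  proof -
    have "jump_size X \<mu> \<rho> < \<infinity>"
      using assms(5) by (simp add: compatible_metric_def)
    then obtain s where s: "0 \<le> s" "jump_size X \<mu> \<rho> = ennreal s"
      by (cases "jump_size X \<mu> \<rho>") auto
    have "\<rho> x y \<le> s" if "adj X \<mu> x y" for x y
    proof -
      have "ennreal (\<rho> x y) \<le> jump_size X \<mu> \<rho>"
        unfolding jump_size_def using that by (intro SUP_upper2 [of "(x, y)"]) auto
      then show ?thesis
        using s by simp
    qed
    then show ?thesis by (rule that)
  qed
  show ?thesis
  proof (rule recurrent_if_small_energy_cutoffs)
    fix x y and \<epsilon> :: real assume xy: "x \<in> X" "y \<in> X" and "0 < \<epsilon>"
    \<comment> \<open>Scales from \<open>4 ^ K\<close> on do not interact, and their cutoffs equal \<open>1\<close> at \<open>x\<close> and \<open>y\<close>.\<close>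
    obtain K where K: "max s (max (2 * \<rho> x x\<^sub>0) (2 * \<rho> y x\<^sub>0)) < 4 ^ K"
      using real_arch_pow [of 4 "max s (max (2 * \<rho> x x\<^sub>0) (2 * \<rho> y x\<^sub>0))"]
      by (auto simp del: max_less_iff_conj)
    have jump: "\<rho> a b \<le> 4 ^ K" if "adj X \<mu> a b" for a b
      using s [OF that] K by auto
    obtain N where N: "8 / \<epsilon> < (\<Sum>k\<in>{K..<N}. w k)"
    proof -
      have "\<not> summable (\<lambda>k. w (k + K))"
        using \<open>\<not> summable w\<close> by (simp add: summable_iff_shift)
      then obtain n where "8 / \<epsilon> < (\<Sum>k<n. w (k + K))"
        using w_nonneg by (meson summableI_nonneg_bounded not_le)
      also have "\<dots> = (\<Sum>k\<in>{K..<n + K}. w k)"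
        using sum.shift_bounds_nat_ivl [of w 0 K n] by (simp add: atLeast0LessThan)
      finally show ?thesis by (rule that)
    qed
    define S where "S = (\<Sum>k\<in>{K..<N}. w k)"
    define g where "g x = (\<Sum>k\<in>{K..<N}. w k / S * cutoff (4 ^ k) x)" for x
    have S: "0 < S" "8 / S \<le> \<epsilon>"
    proof -
      have "0 < 8 / \<epsilon>" using \<open>0 < \<epsilon>\<close> by simp
      then show "0 < S" using N unfolding S_def by linarith
      then show "8 / S \<le> \<epsilon>" using N \<open>0 < \<epsilon>\<close> by (simp add: S_def field_simps)
    qed
    have weights: "(\<Sum>k\<in>{K..<N}. w k / S) = 1"
      using S by (simp add: S_def flip: sum_divide_distrib)
    have g_1: "g z = 1" if "2 * \<rho> z x\<^sub>0 < 4 ^ K" for z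
    proof -
      have "cutoff (4 ^ k) z = 1" if "K \<le> k" for k
      proof (rule cutoff_eq_1)
        have "(4::real) ^ K \<le> 4 ^ k"
          using that by simp
        then show "2 * \<rho> z x\<^sub>0 \<le> 4 ^ k"
          using \<open>2 * \<rho> z x\<^sub>0 < 4 ^ K\<close> by linarith
      qed simp
      then show ?thesis
        using weights by (simp add: g_def)
    qed
    have "0 \<le> g z \<and> g z \<le> 1" for z
    proof
      show "0 \<le> g z"
        using S w_nonneg by (auto simp: g_def cutoff_bounds intro!: sum_nonneg)
      have "g z \<le> (\<Sum>k\<in>{K..<N}. w k / S)"
        unfolding g_def using S w_nonneg
        by (intro sum_mono mult_left_le) (auto simp: cutoff_bounds)
      then show "g z \<le> 1" using weights by simp
    qed
    moreover have "g z = 0" if "z \<in> X" "z \<notin> metric_ball X \<rho> x\<^sub>0 (4 ^ N)" for z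
    proof -
      have "cutoff (4 ^ k) z = 0" if "k < N" for k
      proof (rule cutoff_eq_0)
        have "(4::real) ^ k \<le> 4 ^ N"
          using that by simp
        moreover have "4 ^ N < \<rho> z x\<^sub>0"
          using \<open>z \<in> X\<close> \<open>z \<notin> _\<close> by (simp add: metric_ball_def)
        ultimately show "4 ^ k \<le> \<rho> z x\<^sub>0"
          by linarith
      qed simp
      then show ?thesis
        by (simp add: g_def)
    qed
    moreover have "bdd_above (weighted_deg X \<mu> m ` metric_ball X \<rho> x\<^sub>0 (4 ^ N))"
      using assms(5) by (simp add: compatible_metric_def)
    ultimately have "(\<integral>\<^sup>+x. \<integral>\<^sup>+y. ennreal (\<mu> x y * (g x)\<^sup>2) \<partial>count_space X \<partial>count_space X) < \<infinity>"
      by (intro finite_mass_if_supported_in_ball [of "4 ^ N"] vol_finite) auto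
    moreover have "energy g \<le> ennreal (8 / S)"
      unfolding g_def w_def
      by (rule energy_multiscale_cutoff_le)
         (use jump vol_finite ball_volume_pos S in \<open>auto simp: S_def w_def\<close>)
    then have "energy g \<le> ennreal \<epsilon>"
      using S by (meson ennreal_leI order_trans)
    ultimately show "\<exists>g. g x = 1 \<and> g y = 1 \<and>
        (\<integral>\<^sup>+x. \<integral>\<^sup>+y. ennreal (\<mu> x y * (g x)\<^sup>2) \<partial>count_space X \<partial>count_space X) < \<infinity> \<and>
        energy g \<le> ennreal \<epsilon>"
      using g_1 K by (intro exI [of _ g]) auto
  qed fact
qed

end
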